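(* For every integer $d\ge1$ and every integer $n\ge d$, $$\inf_{a\in[0,1]^{n-1}}L^{\mathrm{wp}}_{d,n}(a)\le R_d .$$
   Context: Model. An admissible strategy is a sequence $a=(a_i)_{i\ge 0}$ with $a_i\in[0,1]$ and $a_0=\tfrac12$; $\mathcal A$ is the set of admissible strategies. Extend $a$ to a signed sequence $(b_i)_{i\in\mathbb Z}$ by $b_i=a_i$ for $i\ge0$ and $b_i=1-a_{-i}$ for $i<0$. Two independent Markov chains $(X_t)_{t\ge0},(Y_t)_{t\ge 0}$ on $\mathbb Z$ start at $X_0=Y_0=0$; each moves from $k$ to $k+1$ with probability $b_k$ and to $k-1$ with probability $1-b_k$. For an integer $d\ge1$ the rendezvous time is $\mathcal T_d(a)=\inf\{t\ge0: X_t=Y_t+2d\}$, and $R_d=\inf_{a\in\mathcal A}\mathbb E[\mathcal T_d(a)]$. Weak-peek chain. Fix $d\ge1$, $n\ge d$, $a=(a_1,\dots,a_{n-1})\in[0,1]^{n-1}$, set $a_0=\frac12$, and for $|i|<n$ let $b_i=a_i$ if $0\le i<n$ and $b_i=1-a_{-i}$ if $-n<i<0$. The level-$n$ weak-peek chain has states $S_{i,j}$ with $-n\le i\le n+2d$, $-n-2d\le j\le n$, $i-j\le 2d$, $i-j$ even; states with $i-j=2d$ are absorbing. From any other state $S_{i,j}$ the two coordinates move independently: the first moves to $i+1$ with probability $1$ if $|i|\ge n$, and otherwise to $i+1$ with probability $b_i$ and to $i-1$ with probability $1-b_i$; the second moves to $j-1$ with probability $1$ if $|j|\ge n$, and otherwise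 to $j+1$ with probability $b_j$ and to $j-1$ with probability $1-b_j$. $L^{\mathrm{wp}}_{d,n}(a)\in[0,\infty]$ is the expected hitting time of the absorbing set starting from $S_{0,0}$. *)

theory Defs
  imports "HOL-Probability.Probability"
begin

section \<open>Discrete-time Markov chains\<close>

text \<open>
  The law, on the path space \<open>nat \<Rightarrow> 's\<close>, of the time-homogeneous Markov chain with initial state
  \<open>s\<close> and transition probabilities \<open>K\<close>.  It is obtained from the Ionescu-Tulcea theorem;
  \<open>emeasure_path_measure_cylinder\<close> below gives its finite-dimensional distributions.
\<close>

definition chain_step :: "('s \<Rightarrow> 's pmf) \<Rightarrow> 's \<Rightarrow> nat \<Rightarrow> (nat \<Rightarrow> 's) \<Rightarrow> 's measure" where
  "chain_step K s t \<omega> =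
     measure_pmf (case t of 0 \<Rightarrow> return_pmf s | Suc u \<Rightarrow> K (\<omega> u))"

definition path_measure :: "('s \<Rightarrow> 's pmf) \<Rightarrow> 's \<Rightarrow> (nat \<Rightarrow> 's) measure" where
  "path_measure K s =
     projective_family.lim UNIV
       (Ionescu_Tulcea.CI (chain_step K s) (\<lambda>_. count_space UNIV)) (\<lambda>_. count_space UNIV)"

lemma Ionescu_Tulcea_chain_step:
  "Ionescu_Tulcea (chain_step K s) (\<lambda>_. count_space UNIV)"
proof (rule Ionescu_Tulcea.intro)
  fix t
  show "chain_step K s t
          \<in> measurable (PiM {0..<t} (\<lambda>_. count_space UNIV)) (subprob_algebra (count_space UNIV))"
  proof (cases t)
    case 0
    then show ?thesis
      by (simp add: chain_step_def [abs_def] measure_pmf_in_subprob_algebra)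
  next
    case (Suc u)
    have "(\<lambda>\<omega>. \<omega> u) \<in> measurable (PiM {0..<t} (\<lambda>_. count_space UNIV)) (count_space UNIV)"
      using Suc by (intro measurable_component_singleton) auto
    moreover have "(\<lambda>x. measure_pmf (K x))
        \<in> measurable (count_space UNIV) (subprob_algebra (count_space UNIV))"
      by (simp add: measure_pmf_in_subprob_algebra)
    ultimately have "(\<lambda>\<omega>. measure_pmf (K (\<omega> u)))
        \<in> measurable (PiM {0..<t} (\<lambda>_. count_space UNIV)) (subprob_algebra (count_space UNIV))"
      by (rule measurable_compose)
    with Suc show ?thesis
      by (simp add: chain_step_def [abs_def])
  qed
qed (simp add: chain_step_def measure_pmf.prob_space_axioms)

lemma prob_space_path_measure: "prob_space (path_measure K s)"
proof -
  interpret IT: Ionescu_Tulcea "chain_step K s" "\<lambda>_. count_space UNIV"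
    by (rule Ionescu_Tulcea_chain_step)
  interpret C: prob_space "IT.C 0 0 (\<lambda>_. undefined)"
    by (rule IT.prob_space_C) simp
  have "prob_space (distr (path_measure K s) (PiM {} (\<lambda>_. count_space UNIV))
          (\<lambda>x. restrict x {}))"
    unfolding path_measure_def
    by (subst IT.distr_lim) (auto intro: IT.PF.prob_space_P)
  then show ?thesis
    by (rule prob_space_distrD [rotated])
       (simp add: path_measure_def measurable_cong_sets [OF IT.PF.sets_lim refl]
          measurable_restrict)
qed

lemma sets_path_measure [measurable_cong, simp]:
  "sets (path_measure K s) = sets (PiM UNIV (\<lambda>_. count_space UNIV))"
proof -
  interpret IT: Ionescu_Tulcea "chain_step K s" "\<lambda>_. count_space UNIV"
    by (rule Ionescu_Tulcea_chain_step)
  show ?thesis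
    by (simp add: path_measure_def)
qed

lemma space_path_measure [simp]: "space (path_measure K s) = UNIV"
  using sets_eq_imp_space_eq [OF sets_path_measure [of K s]] by (simp add: space_PiM)

lemma emeasure_path_measure_cylinder:
  fixes K :: "'s \<Rightarrow> 's pmf" and x :: "nat \<Rightarrow> 's"
  shows "emeasure (path_measure K s) {\<omega>. \<forall>i\<le>t. \<omega> i = x i} =
     (if x 0 = s then ennreal (\<Prod>i<t. pmf (K (x i)) (x (Suc i))) else 0)"
proof -
  let ?M = "\<lambda>_::nat. count_space (UNIV :: 's set)"
  interpret IT: Ionescu_Tulcea "chain_step K s" ?M
    by (rule Ionescu_Tulcea_chain_step)
  define A where "A n = {restrict x {0..<n}}" for n
  have A_PiE: "A n = (\<Pi>\<^sub>E i\<in>{0..<n}. {x i})" for n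
    by (auto simp: A_def PiE_iff restrict_def extensional_def fun_eq_iff)
  have A [measurable]: "A n \<in> sets (PiM {0..<n} ?M)" for n
    unfolding A_PiE by (intro sets_PiM_I_finite) auto
  have u: "(\<lambda>_::nat. undefined) \<in> space (PiM {0..<0} ?M)"
    by simp
  have C: "emeasure (IT.C 0 n (\<lambda>_. undefined)) (A n)
      = (\<Prod>i<n. emeasure (chain_step K s i x) {x i})" for n
  proof (induction n)
    case 0
    have "A 0 = {\<lambda>_. undefined}"
      by (auto simp: A_def)
    then show ?case
      by (simp add: PiM_empty)
  next
    case (Suc n)
    have eP: "emeasure (IT.eP n \<omega>) (A (Suc n))
        = emeasure (chain_step K s n x) {x n} * indicator (A n) \<omega>"
      if "\<omega> \<in> space (PiM {0..<n} ?M)" for \<omega>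
    proof -
      have ext: "\<omega> \<in> extensional {0..<n}"
        using that by (auto simp: space_PiM PiE_iff)
      have iff: "fun_upd \<omega> n y \<in> A (Suc n) \<longleftrightarrow> \<omega> \<in> A n \<and> y = x n" for y
        using ext by (auto simp: A_PiE PiE_iff extensional_def less_Suc_eq)
      have step: "chain_step K s n \<omega> = chain_step K s n x" if "\<omega> \<in> A n"
        using that by (cases n) (auto simp: A_def chain_step_def)
      have "emeasure (IT.eP n \<omega>) (A (Suc n))
          = emeasure (chain_step K s n \<omega>) {y. fun_upd \<omega> n y \<in> A (Suc n)}"
        using that by (subst IT.emeasure_eP) (auto simp: vimage_def)
      then show ?thesis
        using step by (cases "\<omega> \<in> A n") (simp_all add: iff)
    qed
    have "emeasure (IT.C 0 (Suc n) (\<lambda>_. undefined)) (A (Suc n))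
        = (\<integral>\<^sup>+\<omega>. emeasure (IT.eP n \<omega>) (A (Suc n)) \<partial>IT.C 0 n (\<lambda>_. undefined))"
    proof -
      have "space (IT.C 0 n (\<lambda>_. undefined)) \<noteq> {}"
        by (rule prob_space.not_empty [OF IT.prob_space_C [OF u]])
      moreover have "sets (IT.C 0 n (\<lambda>_. undefined)) = sets (PiM {0..<n} ?M)"
        using IT.sets_C [OF u, of n] by simp
      then have "IT.eP n \<in> measurable (IT.C 0 n (\<lambda>_. undefined))
          (subprob_algebra (PiM {0..<Suc n} ?M))"
        using IT.measurable_eP [of n] by (simp cong: measurable_cong_sets)
      ultimately show ?thesis
        using emeasure_bind [OF _ _ A] by (simp only: IT.C.simps add_0)
    qed
    also have "\<dots> = (\<integral>\<^sup>+\<omega>. emeasure (chain_step K s n x) {x n} * indicator (A n) \<omega>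
        \<partial>IT.C 0 n (\<lambda>_. undefined))"
      using IT.space_C [OF u, of n] by (intro nn_integral_cong eP) simp
    also have "\<dots> = emeasure (chain_step K s n x) {x n} * emeasure (IT.C 0 n (\<lambda>_. undefined)) (A n)"
      using IT.sets_C [OF u, of n] by (intro nn_integral_cmult_indicator) simp
    finally show ?case
      by (simp add: Suc.IH mult.commute)
  qed
  have "{\<omega>. \<forall>i\<le>t. \<omega> i = x i} = IT.PF.emb UNIV {0..<Suc t} (A (Suc t))"
    by (auto simp: A_PiE prod_emb_def space_PiM PiE_iff less_Suc_eq_le)
  then have "emeasure (path_measure K s) {\<omega>. \<forall>i\<le>t. \<omega> i = x i}
      = emeasure (IT.CI {0..<Suc t}) (A (Suc t))"
    by (simp add: path_measure_def IT.lim)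
  also have "\<dots> = emeasure (IT.C 0 (Suc t) (\<lambda>_. undefined)) (A (Suc t))"
    by (subst IT.emeasure_CI [of _ "Suc t"]) (auto simp: prod_emb_id [OF sets.sets_into_space [OF A, unfolded space_PiM]])
  also have "\<dots> = (\<Prod>i<Suc t. emeasure (chain_step K s i x) {x i})"
    by (rule C)
  also have "\<dots> = (if x 0 = s then ennreal (\<Prod>i<t. pmf (K (x i)) (x (Suc i))) else 0)"
    by (subst prod.lessThan_Suc_shift)
       (auto simp: chain_step_def emeasure_pmf_single prod_ennreal)
  finally show ?thesis .
qed

text \<open>The infimum in \<open>ennreal\<close> of the empty set is \<open>\<infinity>\<close>, the value when the event never occurs.\<close>

definition first_time :: "(nat \<Rightarrow> bool) \<Rightarrow> ennreal" where
  "first_time P = (INF t\<in>{t. P t}. of_nat t)"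


section \<open>The rendezvous problem\<close>

definition strategies :: "(nat \<Rightarrow> real) set" where
  "strategies = {a. a 0 = 1/2 \<and> (\<forall>i. a i \<in> {0..1})}"

definition signed_ext :: "(nat \<Rightarrow> real) \<Rightarrow> int \<Rightarrow> real" where
  "signed_ext a i = (if 0 \<le> i then a (nat i) else 1 - a (nat (- i)))"

definition walk :: "(int \<Rightarrow> real) \<Rightarrow> int \<Rightarrow> int pmf" where
  "walk b k = map_pmf (\<lambda>up. if up then k + 1 else k - 1) (bernoulli_pmf (b k))"

definition rendezvous_time :: "nat \<Rightarrow> (nat \<Rightarrow> int) \<Rightarrow> (nat \<Rightarrow> int) \<Rightarrow> ennreal" where
  "rendezvous_time d X Y = first_time (\<lambda>t. X t = Y t + 2 * int d)"

definition expected_rendezvous_time :: "nat \<Rightarrow> (nat \<Rightarrow> real) \<Rightarrow> ennreal" where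
  "expected_rendezvous_time d a =
     (\<integral>\<^sup>+(X, Y). rendezvous_time d X Y
        \<partial>(path_measure (walk (signed_ext a)) 0 \<Otimes>\<^sub>M path_measure (walk (signed_ext a)) 0))"

definition R :: "nat \<Rightarrow> ennreal" where
  "R d = (INF a\<in>strategies. expected_rendezvous_time d a)"


section \<open>The weak-peek chain\<close>

definition wp_states :: "nat \<Rightarrow> nat \<Rightarrow> (int \<times> int) set" where
  "wp_states d n = {(i, j).
     - int n \<le> i \<and> i \<le> int n + 2 * int d \<and> - int n - 2 * int d \<le> j \<and> j \<le> int n \<and>
     i - j \<le> 2 * int d \<and> even (i - j)}"

definition wp_absorbing :: "nat \<Rightarrow> nat \<Rightarrow> (int \<times> int) set" where
  "wp_absorbing d n = {(i, j) \<in> wp_states d n. i - j = 2 * int d}"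

text \<open>
  A vector \<open>(a\<^sub>1, \<dots>, a\<^sub>n\<^sub>-\<^sub>1)\<close> is a function on \<open>{1..<n}\<close>; the update at \<open>0\<close> sets \<open>a\<^sub>0 = 1/2\<close>.
  \<open>wp_bias a i\<close> is only used for \<open>\<bar>i\<bar> < n\<close>.
\<close>

definition wp_bias :: "(nat \<Rightarrow> real) \<Rightarrow> int \<Rightarrow> real" where
  "wp_bias a = signed_ext (a(0 := 1/2))"

definition wp_first :: "nat \<Rightarrow> (nat \<Rightarrow> real) \<Rightarrow> int \<Rightarrow> int pmf" where
  "wp_first n a i = (if \<bar>i\<bar> \<ge> int n then return_pmf (i + 1) else walk (wp_bias a) i)"

definition wp_second :: "nat \<Rightarrow> (nat \<Rightarrow> real) \<Rightarrow> int \<Rightarrow> int pmf" where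
  "wp_second n a j = (if \<bar>j\<bar> \<ge> int n then return_pmf (j - 1) else walk (wp_bias a) j)"

text \<open>
  The kernel is a function on all of \<open>int \<times> int\<close>, but \<open>wp_states\<close> is closed under its transitions
  (\<open>wp_kernel_closed\<close>), so its values elsewhere are irrelevant for the chain started at \<open>(0, 0)\<close>.
\<close>

definition wp_kernel :: "nat \<Rightarrow> nat \<Rightarrow> (nat \<Rightarrow> real) \<Rightarrow> int \<times> int \<Rightarrow> (int \<times> int) pmf" where
  "wp_kernel d n a = (\<lambda>(i, j).
     if (i, j) \<in> wp_absorbing d n then return_pmf (i, j)
     else pair_pmf (wp_first n a i) (wp_second n a j))"

lemma wp_kernel_closed:
  assumes "1 \<le> n" and "s \<in> wp_states d n" and "s' \<in> set_pmf (wp_kernel d n a s)"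
  shows "s' \<in> wp_states d n"
proof -
  obtain i j i' j' where s: "s = (i, j)" "s' = (i', j')"
    by (metis surj_pair)
  have walk: "k' = k + 1 \<or> k' = k - 1" if "k' \<in> set_pmf (walk b k)" for k k' b
    using that by (auto simp: walk_def split: if_splits)
  show ?thesis
  proof (cases "s \<in> wp_absorbing d n")
    case True
    then show ?thesis
      using assms s by (auto simp: wp_kernel_def)
  next
    case False
    then have "i' \<in> set_pmf (wp_first n a i)" "j' \<in> set_pmf (wp_second n a j)"
      using assms(3) s by (auto simp: wp_kernel_def)
    then have i': "i' = i + 1 \<or> i' = i - 1 \<and> \<bar>i\<bar> < int n"
      and j': "j' = j - 1 \<or> j' = j + 1 \<and> \<bar>j\<bar> < int n"
      using walk by (auto simp: wp_first_def wp_second_def split: if_splits)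
    have ij: "- int n \<le> i" "j \<le> int n" "i - j \<le> 2 * int d" "even (i - j)"
      using assms(2) s by (auto simp: wp_states_def)
    have "i - j \<noteq> 2 * int d"
      using False assms(2) s by (auto simp: wp_absorbing_def)
    then have "i - j \<le> 2 * int d - 2"
      using ij by presburger
    then have "- int n \<le> i'" "j' \<le> int n" "i' - j' \<le> 2 * int d"
      using i' j' ij by auto
    moreover have "even (i' - j')"
      using i' j' ij(4) by (elim disjE conjE) simp_all
    ultimately show ?thesis
      using s by (auto simp: wp_states_def)
  qed
qed

definition L_wp :: "nat \<Rightarrow> nat \<Rightarrow> (nat \<Rightarrow> real) \<Rightarrow> ennreal" where
  "L_wp d n a =
     (\<integral>\<^sup>+\<omega>. first_time (\<lambda>t. \<omega> t \<in> wp_absorbing d n) \<partial>path_measure (wp_kernel d n a) (0, 0))"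

end

(*
  At a site k with |k| < n the weak-peek chain moves like the walk, and at the remaining sites it is
  pushed in the favourable direction with certainty.  The two chains keep the same parity, so their
  order can only be exchanged at a meeting point.  Hence the first coordinates can be coupled with the
  weak-peek one always weakly to the right, and the second ones with the weak-peek one weakly to the
  left.  The gap 2d is then closed no later in the weak-peek chain, for the same strategy cut off at n.
*)
theory Submission
  imports Defs
begin

section \<open>Expected first times as sums of tail probabilities\<close>

text \<open>If the event first occurs at \<open>T\<close>, the times \<open>t\<close> with no
  occurrence up to and including \<open>t\<close> are exactly those below \<open>T\<close>, so
  counting them gives \<open>T\<close>. If it never occurs, every time counts and both sides are
  infinite.\<close>

lemma first_time_eq_suminf:
  "first_time P = (\<Sum>t. indicator {t. \<forall>s\<le>t. \<not> P s} t)"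
proof (cases "\<exists>t. P t")
  case True
  define T where "T = (LEAST t. P t)"
  have least: "T \<le> t" if "P t" for t
    using that by (simp add: T_def Least_le)
  have PT: "P T"
    using True by (auto simp: T_def intro: LeastI_ex)
  have "{t. \<forall>s\<le>t. \<not> P s} = {..<T}"
    using PT least by (force simp: not_le)
  then have "(\<Sum>t. indicator {t. \<forall>s\<le>t. \<not> P s} t :: ennreal) = (\<Sum>t<T. indicator {..<T} t)"
    by (simp only:, intro suminf_finite) auto
  also have "\<dots> = of_nat T"
    by simp
  also have "\<dots> = first_time P"
    unfolding first_time_def
    by (intro antisym INF_greatest INF_lower) (use PT least in auto)
  finally show ?thesis
    by simp
next
  case False
  then have "(\<Sum>t. indicator {t. \<forall>s\<le>t. \<not> P s} t :: ennreal) = (\<Sum>t. 1)"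
    by simp
  also have "\<dots> = \<top>"
  proof -
    have "of_nat k \<le> (\<Sum>t. 1 :: ennreal)" for k
      using sum_le_suminf[of "\<lambda>_. 1 :: ennreal" "{..<k}"] by simp
    then show ?thesis
      by (metis ennreal_Ex_less_of_nat leD top.not_eq_extremum)
  qed
  finally show ?thesis
    using False by (simp add: first_time_def)
qed

text \<open>Integrating the counting formula term by term turns an expected time into probabilities
  of events that involve only finitely many coordinates, which a coupling of finite paths can
  compare.\<close>

lemma nn_integral_first_time:
  assumes [measurable]: "\<And>t. Measurable.pred M (\<lambda>\<omega>. P \<omega> t)"
  shows "(\<integral>\<^sup>+\<omega>. first_time (P \<omega>) \<partial>M) = (\<Sum>t. emeasure M {\<omega> \<in> space M. \<forall>s\<le>t. \<not> P \<omega> s})"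
proof -
  have "(\<integral>\<^sup>+\<omega>. first_time (P \<omega>) \<partial>M)
      = (\<integral>\<^sup>+\<omega>. (\<Sum>t. indicator {\<omega> \<in> space M. \<forall>s\<le>t. \<not> P \<omega> s} \<omega>) \<partial>M)"
    by (intro nn_integral_cong) (simp add: first_time_eq_suminf indicator_def)
  then show ?thesis
    by (simp add: nn_integral_suminf)
qed

section \<open>Finite path prefixes as discrete distributions\<close>

text \<open>The law of the states at times 0 to \<open>t\<close>, including the initial one. As a
  \<open>pmf\<close> on lists it gives access to couplings through \<open>rel_pmf\<close>; splitting
  off the first step suits an induction over the starting state.\<close>

primrec path_pmf :: "('s \<Rightarrow> 's pmf) \<Rightarrow> nat \<Rightarrow> 's \<Rightarrow> 's list pmf" where
  "path_pmf K 0 s = return_pmf [s]"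
| "path_pmf K (Suc t) s = bind_pmf (K s) (\<lambda>s'. map_pmf ((#) s) (path_pmf K t s'))"

lemma length_path_pmf: "xs \<in> set_pmf (path_pmf K t s) \<Longrightarrow> length xs = Suc t"
  by (induction t arbitrary: s xs) auto

lemma pmf_path_pmf:
  "pmf (path_pmf K t s) (map x [0..<Suc t]) =
     (if x 0 = s then \<Prod>i<t. pmf (K (x i)) (x (Suc i)) else 0)"
proof (induction t arbitrary: s x)
  case 0
  then show ?case
    by simp
next
  case (Suc t)
  have split: "map x [0..<Suc (Suc t)] = x 0 # map (x \<circ> Suc) [0..<Suc t]"
    by (simp add: map_upt_Suc comp_def del: upt_Suc)
  show ?case
  proof (cases "x 0 = s")
    case True
    have "pmf (path_pmf K (Suc t) s) (map x [0..<Suc (Suc t)])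
        = measure_pmf.expectation (K s) (\<lambda>s'. pmf (path_pmf K t s') (map (x \<circ> Suc) [0..<Suc t]))"
      unfolding split path_pmf.simps pmf_bind True by (subst pmf_map_inj') (auto simp: inj_def)
    \<comment> \<open>By the induction hypothesis only the successor \<open>x 1\<close> contributes,
      and the remaining factors do not depend on \<open>s'\<close>.\<close>
    also have "\<dots> = measure_pmf.expectation (K s)
        (\<lambda>s'. indicator {x 1} s' * (\<Prod>i<t. pmf (K (x (Suc i))) (x (Suc (Suc i)))))"
      unfolding Suc.IH by (intro Bochner_Integration.integral_cong) (auto simp: indicator_def)
    also have "\<dots> = pmf (K s) (x 1) * (\<Prod>i<t. pmf (K (x (Suc i))) (x (Suc (Suc i))))"
      by (simp add: measure_pmf_single)
    finally show ?thesis
      using True by (simp add: prod.lessThan_Suc_shift del: prod.lessThan_Suc)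
  next
    case False
    then have "x 0 # map (x \<circ> Suc) [0..<Suc t] \<notin> set_pmf (path_pmf K (Suc t) s)"
      by auto
    then show ?thesis
      using False unfolding split pmf_eq_0_set_pmf[symmetric] by (simp only: if_False)
  qed
qed

text \<open>Finite-dimensional distributions determine the law of a prefix. The process
  \<open>Z\<close> on \<open>M\<close> is left abstract so that the result applies both to one chain
  and to a pair of independent chains on a product space.\<close>

lemma emeasure_path_pmf:
  fixes Z :: "'b \<Rightarrow> nat \<Rightarrow> 's::countable"
  assumes meas [measurable]: "\<And>t. (\<lambda>\<omega>. Z \<omega> t) \<in> measurable M (count_space UNIV)"
    and cyl: "\<And>x. emeasure M {\<omega> \<in> space M. \<forall>i\<le>t. Z \<omega> i = x i} =
      (if x 0 = s then ennreal (\<Prod>i<t. pmf (K (x i)) (x (Suc i))) else 0)"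
  shows "emeasure M {\<omega> \<in> space M. \<forall>i\<le>t. Q (Z \<omega> i)}
    = emeasure (path_pmf K t s) {xs. \<forall>x\<in>set xs. Q x}"
proof -
  define f where "f \<omega> = map (Z \<omega>) [0..<Suc t]" for \<omega>
  have f_eq: "f \<omega> = xs \<longleftrightarrow> length xs = Suc t \<and> (\<forall>i\<le>t. Z \<omega> i = xs ! i)" for \<omega> xs
    by (auto simp: f_def list_eq_iff_nth_eq less_Suc_eq_le simp del: upt_Suc)
  have f_vimage: "f -` {xs} \<inter> space M
      = {\<omega> \<in> space M. length xs = Suc t \<and> (\<forall>i\<le>t. Z \<omega> i = xs ! i)}" for xs
    unfolding f_eq[symmetric] by auto
  have f: "f \<in> measurable M (count_space UNIV)"
  proof (subst measurable_count_space_eq_countable, simp, intro conjI ballI)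
    show "f -` {xs} \<inter> space M \<in> sets M" for xs
      unfolding f_vimage by measurable
  qed simp
  \<comment> \<open>Lists over a countable type are countable, so it suffices to compare single
    lists. A list of length \<open>Suc t\<close> corresponds to a cylinder; any other length has
    mass 0 on both sides.\<close>
  have "distr M (count_space UNIV) f = measure_pmf (path_pmf K t s)"
  proof (rule measure_eqI_countable[where A = UNIV])
    fix xs :: "'s list"
    have "emeasure (distr M (count_space UNIV) f) {xs}
        = emeasure M {\<omega> \<in> space M. length xs = Suc t \<and> (\<forall>i\<le>t. Z \<omega> i = xs ! i)}"
      using f by (simp add: emeasure_distr f_vimage)
    also have "\<dots> = emeasure (path_pmf K t s) {xs}"
    proof (cases "length xs = Suc t")
      case True
      then have "xs = map ((!) xs) [0..<Suc t]"
        by (metis map_nth)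
      then have "pmf (path_pmf K t s) xs
          = (if xs ! 0 = s then \<Prod>i<t. pmf (K (xs ! i)) (xs ! Suc i) else 0)"
        using pmf_path_pmf[of K t s "(!) xs"] by simp
      with True show ?thesis
        using cyl[of "(!) xs"] by (simp add: emeasure_pmf_single)
    next
      case False
      then have "xs \<notin> set_pmf (path_pmf K t s)"
        using length_path_pmf by metis
      with False show ?thesis
        by (simp add: emeasure_pmf_single set_pmf_iff)
    qed
    finally show "emeasure (distr M (count_space UNIV) f) {xs} = emeasure (path_pmf K t s) {xs}" .
  qed auto
  then have "emeasure (path_pmf K t s) {xs. \<forall>x\<in>set xs. Q x}
      = emeasure (distr M (count_space UNIV) f) {xs. \<forall>x\<in>set xs. Q x}"
    by simp
  also have "\<dots> = emeasure M (f -` {xs. \<forall>x\<in>set xs. Q x} \<inter> space M)"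
    using f by (simp add: emeasure_distr)
  also have "f -` {xs. \<forall>x\<in>set xs. Q x} \<inter> space M = {\<omega> \<in> space M. \<forall>i\<le>t. Q (Z \<omega> i)}"
    by (auto simp: f_def less_Suc_eq_le simp del: upt_Suc)
  finally show ?thesis
    by simp
qed

text \<open>One-step couplings that preserve \<open>S\<close> are glued along the path: after each
  coupled step the two new states are again related, so the next coupling can start from
  them.\<close>

lemma rel_path_pmf:
  assumes "\<And>x y. S x y \<Longrightarrow> rel_pmf S (K x) (L y)" and "S x y"
  shows "rel_pmf (list_all2 S) (path_pmf K t x) (path_pmf L t y)"
  using assms(2)
proof (induction t arbitrary: x y)
  case 0
  then show ?case
    by simp
next
  case (Suc t)
  show ?case
    unfolding path_pmf.simps
  proof (rule rel_pmf_bindI)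
    show "rel_pmf S (K x) (L y)"
      using assms(1) Suc.prems .
  next
    fix x' y' assume "S x' y'"
    then have "rel_pmf (list_all2 S) (path_pmf K t x') (path_pmf L t y')"
      by (rule Suc.IH)
    then show "rel_pmf (list_all2 S) (map_pmf ((#) x) (path_pmf K t x'))
        (map_pmf ((#) y) (path_pmf L t y'))"
      unfolding pmf.rel_map using Suc.prems by (auto elim: pmf.rel_mono_strong)
  qed
qed

lemma measurable_path_component [measurable]:
  "(\<lambda>\<omega>. \<omega> t) \<in> measurable (path_measure K s) (count_space UNIV)"
  by (simp cong: measurable_cong_sets)

lemma emeasure_path_measure_all:
  fixes K :: "'s::countable \<Rightarrow> 's pmf"
  shows "emeasure (path_measure K s) {\<omega>. \<forall>i\<le>t. Q (\<omega> i)}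
    = emeasure (path_pmf K t s) {xs. \<forall>x\<in>set xs. Q x}"
  using emeasure_path_pmf[of "\<lambda>\<omega>. \<omega>" "path_measure K s" t s K Q]
  by (simp add: emeasure_path_measure_cylinder)

text \<open>Two independent chains form one chain on pairs, with kernel the product of the two
  kernels: a cylinder of pairs is a rectangle, so its measure is the product of two cylinder
  formulas.\<close>

lemma emeasure_pair_path_measure_all:
  fixes K :: "'s::countable \<Rightarrow> 's pmf" and L :: "'t::countable \<Rightarrow> 't pmf" and x0 y0
  defines "M \<equiv> path_measure K x0 \<Otimes>\<^sub>M path_measure L y0"
  shows "emeasure M {\<omega> \<in> space M. \<forall>i\<le>t. Q (fst \<omega> i, snd \<omega> i)}
    = emeasure (path_pmf (\<lambda>(x, y). pair_pmf (K x) (L y)) t (x0, y0)) {xs. \<forall>x\<in>set xs. Q x}"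
proof (rule emeasure_path_pmf)
  interpret K: prob_space "path_measure K x0"
    by (rule prob_space_path_measure)
  interpret L: prob_space "path_measure L y0"
    by (rule prob_space_path_measure)
  have "(\<lambda>\<omega>. (fst \<omega> i, snd \<omega> i)) \<in> measurable M (count_space UNIV \<Otimes>\<^sub>M count_space UNIV)" for i
    unfolding M_def by measurable
  then show "(\<lambda>\<omega>. (fst \<omega> i, snd \<omega> i)) \<in> measurable M (count_space UNIV)" for i
    by (simp add: pair_measure_countable)
  have pmf_pair: "pmf (pair_pmf A B) z = pmf A (fst z) * pmf B (snd z)"
    for A :: "'s pmf" and B :: "'t pmf" and z
    by (cases z) (simp add: pmf_pair)
  fix z :: "nat \<Rightarrow> 's \<times> 't"
  have sets: "{\<omega>. \<forall>i\<le>t. \<omega> i = fst (z i)} \<in> sets (path_measure K x0)"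
    "{\<omega>. \<forall>i\<le>t. \<omega> i = snd (z i)} \<in> sets (path_measure L y0)"
  proof -
    have "{\<omega> \<in> space (path_measure K x0). \<forall>i\<le>t. \<omega> i = fst (z i)} \<in> sets (path_measure K x0)"
      by measurable
    then show "{\<omega>. \<forall>i\<le>t. \<omega> i = fst (z i)} \<in> sets (path_measure K x0)"
      by simp
    have "{\<omega> \<in> space (path_measure L y0). \<forall>i\<le>t. \<omega> i = snd (z i)} \<in> sets (path_measure L y0)"
      by measurable
    then show "{\<omega>. \<forall>i\<le>t. \<omega> i = snd (z i)} \<in> sets (path_measure L y0)"
      by simp
  qed
  have "{\<omega> \<in> space M. \<forall>i\<le>t. (fst \<omega> i, snd \<omega> i) = z i}
      = {\<omega>. \<forall>i\<le>t. \<omega> i = fst (z i)} \<times> {\<omega>. \<forall>i\<le>t. \<omega> i = snd (z i)}"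
    by (auto simp: M_def space_pair_measure prod_eq_iff)
  then have "emeasure M {\<omega> \<in> space M. \<forall>i\<le>t. (fst \<omega> i, snd \<omega> i) = z i}
      = emeasure (path_measure K x0) {\<omega>. \<forall>i\<le>t. \<omega> i = fst (z i)}
        * emeasure (path_measure L y0) {\<omega>. \<forall>i\<le>t. \<omega> i = snd (z i)}"
    by (simp add: M_def L.emeasure_pair_measure_Times[OF sets])
  also have "\<dots> = (if z 0 = (x0, y0) then ennreal (\<Prod>i<t.
      pmf (case z i of (x, y) \<Rightarrow> pair_pmf (K x) (L y)) (z (Suc i))) else 0)"
    by (auto simp: emeasure_path_measure_cylinder prod_eq_iff case_prod_beta pmf_pair
        prod.distrib ennreal_mult' prod_nonneg)
  finally show "emeasure M {\<omega> \<in> space M. \<forall>i\<le>t. (fst \<omega> i, snd \<omega> i) = z i}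
      = (if z 0 = (x0, y0) then ennreal (\<Prod>i<t.
      pmf (case z i of (x, y) \<Rightarrow> pair_pmf (K x) (L y)) (z (Suc i))) else 0)" .
qed

section \<open>Monotone one-step couplings of a single coordinate\<close>

lemma set_pmf_walk: "set_pmf (walk b k) \<subseteq> {k - 1, k + 1}"
  by (auto simp: walk_def)

text \<open>The product coupling is a witness, since all pairs of attainable values are
  related.\<close>

lemma rel_pmf_independent:
  assumes "\<And>x y. x \<in> set_pmf p \<Longrightarrow> y \<in> set_pmf q \<Longrightarrow> S x y"
  shows "rel_pmf S p q"
  by (rule rel_pmf.intros[of "pair_pmf p q"])
    (use assms in \<open>auto simp: map_fst_pair_pmf map_snd_pair_pmf\<close>)

lemma walk_cong: "b k = c k \<Longrightarrow> walk b k = walk c k"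
  by (simp add: walk_def)

text \<open>At a common site with \<open>\<bar>x\<bar> < int n\<close> the two laws agree, so both
  chains can move together. At a common site outside this range the weak-peek coordinate moves right
  for certain. Otherwise parity makes the gap at least 2, and one step of each chain shrinks it by
  at most 2. In the last two cases any coupling preserves the order.\<close>

lemma rel_pmf_walk_wp_first:
  assumes bias: "\<And>i. \<bar>i\<bar> < int n \<Longrightarrow> wp_bias a i = b i"
    and "x \<le> x'" "even (x' - x)"
  shows "rel_pmf (\<lambda>x x'. x \<le> x' \<and> even (x' - x)) (walk b x) (wp_first n a x')"
proof (cases "x = x' \<and> \<bar>x\<bar> < int n")
  case True
  then have "wp_first n a x' = walk b x"
    using bias by (auto simp: wp_first_def intro: walk_cong)
  then show ?thesis
    by (auto intro: rel_pmf_reflI)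
next
  case False
  have "x = x' \<or> x + 2 \<le> x'"
    using assms(2,3) by presburger
  moreover have "set_pmf (wp_first n a x') \<subseteq> (if \<bar>x'\<bar> < int n then {x' - 1, x' + 1} else {x' + 1})"
    using set_pmf_walk by (auto simp: wp_first_def)
  ultimately show ?thesis
    using False assms(3) set_pmf_walk[of b x]
    by (intro rel_pmf_independent) (fastforce split: if_splits)
qed

text \<open>Mirror image of the coupling for the first coordinate: the certain move now goes left,
  and the order is reversed.\<close>

lemma rel_pmf_walk_wp_second:
  assumes bias: "\<And>i. \<bar>i\<bar> < int n \<Longrightarrow> wp_bias a i = b i"
    and "y' \<le> y" "even (y - y')"
  shows "rel_pmf (\<lambda>y y'. y' \<le> y \<and> even (y - y')) (walk b y) (wp_second n a y')"
proof (cases "y = y' \<and> \<bar>y\<bar> < int n")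
  case True
  then have "wp_second n a y' = walk b y"
    using bias by (auto simp: wp_second_def intro: walk_cong)
  then show ?thesis
    by (auto intro: rel_pmf_reflI)
next
  case False
  have "y = y' \<or> y' + 2 \<le> y"
    using assms(2,3) by presburger
  moreover have "set_pmf (wp_second n a y') \<subseteq> (if \<bar>y'\<bar> < int n then {y' - 1, y' + 1} else {y' - 1})"
    using set_pmf_walk by (auto simp: wp_second_def)
  ultimately show ?thesis
    using False assms(3) set_pmf_walk[of b y]
    by (intro rel_pmf_independent) (fastforce split: if_splits)
qed

section \<open>Coupling the pair of walks with the weak-peek chain\<close>

text \<open>An absorbed weak-peek chain stands still while the walks go on, so the order can be lost
  afterwards; the first disjunct therefore relates an absorbed state to every pair. Membership in
  \<open>wp_states\<close> carries the bound \<open>2 * int d\<close> on the gap.\<close>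

definition ahead :: "nat \<Rightarrow> nat \<Rightarrow> int \<times> int \<Rightarrow> int \<times> int \<Rightarrow> bool" where
  "ahead d n s s' \<longleftrightarrow> s' \<in> wp_absorbing d n \<or> s' \<in> wp_states d n \<and>
     rel_prod (\<lambda>x x'. x \<le> x' \<and> even (x' - x)) (\<lambda>y y'. y' \<le> y \<and> even (y - y')) s s'"

text \<open>Before absorption both kernels are products, so the couplings of the two coordinates
  combine independently, and \<open>wp_kernel_closed\<close> keeps the state legal.\<close>

lemma rel_pmf_wp_kernel:
  assumes "1 \<le> n" and bias: "\<And>i. \<bar>i\<bar> < int n \<Longrightarrow> wp_bias a i = b i"
    and "ahead d n s s'"
  shows "rel_pmf (ahead d n) (case s of (x, y) \<Rightarrow> pair_pmf (walk b x) (walk b y))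
    (wp_kernel d n a s')"
proof (cases "s' \<in> wp_absorbing d n")
  case True
  then have "wp_kernel d n a s' = return_pmf s'"
    by (simp add: wp_kernel_def case_prod_beta)
  then show ?thesis
    using True by (intro rel_pmf_independent) (auto simp: ahead_def)
next
  case False
  obtain x y x' y' where s: "s = (x, y)" "s' = (x', y')"
    by (metis surj_pair)
  have states: "s' \<in> wp_states d n" and le: "x \<le> x'" "even (x' - x)" "y' \<le> y" "even (y - y')"
    using False assms(3) s by (auto simp: ahead_def)
  have kernel: "wp_kernel d n a s' = pair_pmf (wp_first n a x') (wp_second n a y')"
    using False s by (simp add: wp_kernel_def)
  have "rel_pmf (rel_prod (\<lambda>x x'. x \<le> x' \<and> even (x' - x)) (\<lambda>y y'. y' \<le> y \<and> even (y - y')))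
      (case s of (x, y) \<Rightarrow> pair_pmf (walk b x) (walk b y)) (wp_kernel d n a s')"
    unfolding kernel unfolding s prod.case rel_pmf_rel_prod using bias le
    by (intro conjI rel_pmf_walk_wp_first rel_pmf_walk_wp_second)
  then show ?thesis
  proof (rule pmf.rel_mono_strong)
    fix z z' assume "z' \<in> set_pmf (wp_kernel d n a s')"
    then have "z' \<in> wp_states d n"
      by (rule wp_kernel_closed[OF assms(1) states])
    moreover assume "rel_prod (\<lambda>x x'. x \<le> x' \<and> even (x' - x)) (\<lambda>y y'. y' \<le> y \<and> even (y - y')) z z'"
    ultimately show "ahead d n z z'"
      by (simp add: ahead_def)
  qed
qed

text \<open>If \<open>x - y\<close> were \<open>2d\<close>, the order would give the weak-peek state
  a gap of at least \<open>2d\<close>. No state has a larger gap, so it would be absorbing.\<close>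

lemma ahead_not_absorbing:
  assumes "ahead d n (x, y) s'" and "s' \<notin> wp_absorbing d n"
  shows "x \<noteq> y + 2 * int d"
  using assms by (auto simp: ahead_def wp_absorbing_def wp_states_def)

section \<open>Comparison of the expected times\<close>

text \<open>Under the coupling, a weak-peek path not absorbed up to time \<open>t\<close> forces the
  walks not to have met up to time \<open>t\<close>. Hence the tail probabilities compare for every
  \<open>t\<close>, and so do their sums.\<close>

lemma L_wp_le_expected_rendezvous_time:
  assumes "1 \<le> n" and bias: "\<And>i. \<bar>i\<bar> < int n \<Longrightarrow> wp_bias a i = signed_ext c i"
  shows "L_wp d n a \<le> expected_rendezvous_time d c"
proof -
  define b where "b = signed_ext c"
  define K where "K = (\<lambda>(x, y). pair_pmf (walk b x) (walk b y))"
  define M where "M = path_measure (walk b) 0 \<Otimes>\<^sub>M path_measure (walk b) 0"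
  have bias: "wp_bias a i = b i" if "\<bar>i\<bar> < int n" for i
    using bias that by (simp add: b_def)
  have "L_wp d n a = (\<Sum>t. emeasure (path_pmf (wp_kernel d n a) t (0, 0))
      {zs. \<forall>z\<in>set zs. z \<notin> wp_absorbing d n})"
    unfolding L_wp_def by (subst nn_integral_first_time) 
      (simp_all add: emeasure_path_measure_all[where Q = "\<lambda>z. z \<notin> wp_absorbing d n"])
  also have "\<dots> \<le> (\<Sum>t. emeasure (path_pmf K t (0, 0))
      {zs. \<forall>z\<in>set zs. fst z \<noteq> snd z + 2 * int d})"
  proof (rule suminf_le)
    fix t
    let ?p = "path_pmf (wp_kernel d n a) t (0, 0)" and ?q = "path_pmf K t (0, 0)"
    let ?A = "{zs. \<forall>z\<in>set zs. z \<notin> wp_absorbing d n}"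
    let ?B = "{zs. \<forall>z\<in>set zs. fst z \<noteq> snd z + 2 * int d}"
    have "rel_pmf (list_all2 (ahead d n)) ?q ?p"
      using rel_pmf_wp_kernel[OF assms(1) bias]
      by (intro rel_path_pmf) (auto simp: K_def ahead_def wp_states_def)
    \<comment> \<open>\<open>rel_pmf_measureD\<close> bounds an event on the left by its relational
      image on the right, so the weak-peek law has to stand on the left.\<close>
    then have "rel_pmf (list_all2 (ahead d n))\<inverse>\<inverse> ?p ?q"
      by (simp add: pmf.rel_conversep)
    then have "measure ?p ?A \<le> measure ?q {zs. \<exists>zs'\<in>?A. (list_all2 (ahead d n))\<inverse>\<inverse> zs' zs}"
      by (rule rel_pmf_measureD)
    also have "\<dots> \<le> measure ?q ?B"
    proof (rule measure_pmf.finite_measure_mono)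
      have "fst z \<noteq> snd z + 2 * int d"
        if zs: "zs' \<in> ?A" "list_all2 (ahead d n) zs zs'" "z \<in> set zs" for z zs zs'
      proof -
        obtain i where "i < length zs" "z = zs ! i"
          using zs(3) by (auto simp: in_set_conv_nth)
        then have "zs' ! i \<in> set zs'" "ahead d n z (zs' ! i)"
          using zs(2) by (auto simp: list_all2_conv_all_nth)
        then show ?thesis
          using zs(1) ahead_not_absorbing[of d n "fst z" "snd z" "zs' ! i"] by auto
      qed
      then show "{zs. \<exists>zs'\<in>?A. (list_all2 (ahead d n))\<inverse>\<inverse> zs' zs} \<subseteq> ?B"
        by blast
    qed simp
    finally show "emeasure ?p ?A \<le> emeasure ?q ?B"
      by (simp add: measure_pmf.emeasure_eq_measure)
  qed auto
  also have "\<dots> = (\<Sum>t. emeasure M {\<omega> \<in> space M. \<forall>i\<le>t. fst \<omega> i \<noteq> snd \<omega> i + 2 * int d})"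
    unfolding M_def K_def emeasure_pair_path_measure_all[symmetric] by simp
  also have "\<dots> = (\<integral>\<^sup>+\<omega>. first_time (\<lambda>t. fst \<omega> t = snd \<omega> t + 2 * int d) \<partial>M)"
    by (subst nn_integral_first_time) (simp_all add: M_def)
  also have "\<dots> = expected_rendezvous_time d c"
    by (simp add: expected_rendezvous_time_def rendezvous_time_def M_def b_def case_prod_beta')
  finally show ?thesis .
qed

theorem lemma5:
  fixes d n :: nat
  assumes "1 \<le> d" and "d \<le> n"
  shows "(INF a\<in>{1..<n} \<rightarrow>\<^sub>E {0..1}. L_wp d n a) \<le> R d"
  unfolding R_def
proof (rule INF_greatest)
  fix c assume c: "c \<in> strategies"
  \<comment> \<open>For \<open>i = 0\<close> the update built into \<open>wp_bias\<close> gives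
    \<open>1/2\<close>, which is \<open>c 0\<close> for a strategy; for all other sites in range,
    \<open>\<bar>i\<bar>\<close> lies in \<open>{1..<n}\<close>, where the restriction agrees with
    \<open>c\<close>.\<close>
  have "wp_bias (restrict c {1..<n}) i = signed_ext c i" if "\<bar>i\<bar> < int n" for i
    using c that by (auto simp: wp_bias_def signed_ext_def strategies_def)
  then have "L_wp d n (restrict c {1..<n}) \<le> expected_rendezvous_time d c"
    using assms by (intro L_wp_le_expected_rendezvous_time) auto
  moreover have "restrict c {1..<n} \<in> {1..<n} \<rightarrow>\<^sub>E {0..1}"
    using c by (auto simp: strategies_def)
  ultimately show "(INF a\<in>{1..<n} \<rightarrow>\<^sub>E {0..1}. L_wp d n a) \<le> expected_rendezvous_time d c"
    by (rule INF_lower2[rotated])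
qed

end
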